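(* Let $A\in\mathbb{R}^{n\times n}$, $B\in\mathbb{R}^{m\times n}$, $C\in\mathbb{R}^{p\times m}$, and consider $$\mathcal{K}=\begin{bmatrix} A & B^T & 0\\ B & -D & C^T\\ 0 & C & 0\end{bmatrix},\qquad D=0\in\mathbb{R}^{m\times m}.$$ Suppose that $\mathcal{K}$ is nonsingular, $A$ is symmetric positive definite, $n\ge m$, and $S_1=BA^{-1}B^T$ and $S_2=CS_1^{-1}C^T$ are well defined and nonsingular. Let $\widehat{S}_2\in\mathbb{R}^{p\times p}$ be symmetric positive definite, and let $$\widehat{\mathcal{M}}_D=\begin{bmatrix} A & 0 & 0\\ 0 & S_1 & 0\\ 0 & 0 & \widehat{S}_2\end{bmatrix}.$$ Then the eigenvalues of the preconditioned matrix $\widehat{\mathcal{M}}_D^{-1}\mathcal{K}$ are: (i) $\lambda=1$, of algebraic multiplicity $n-m$, with corresponding eigenvectors $(x,0,0)$, where $x$ ranges over a set of $n-m$ linearly independent null vectors of $B$ (a basis of $\ker(B)$); (ii) $\lambda=\frac{1\pm\sqrt{5}}{2}$, each of algebraic multiplicity $m-p$, with corresponding eigenvectors $(x,y,0)$ that satisfy $0\ne y\in\ker(C)$ and $x=\frac{1}{\lambda-1}A^{-1}B^Ty$; (iii) the remaining $3p$ eigenvalues are the roots of the $p$ cubic polynomial equations $$\lambda^3-\lambda^2-(1+\mu_i)\lambda+\mu_i=0,\qquad i=1,\dots,p,$$ where $\mu_1,\dots,\mu_p$ are the $p$ eigenvalues of the generalized eigenvalue problem $S_2z=\mu\,\wi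dehat{S}_2z$.
   Context: Vectors in $\mathbb{R}^{n+m+p}$ are partitioned as $(x,y,z)$ with $x\in\mathbb{R}^n$, $y\in\mathbb{R}^m$, $z\in\mathbb{R}^p$. Eigenvalues $\mu_i$ and the roots of the cubics are counted with multiplicity. *)

theory Defs
  imports
    "HOL-Library.Multiset"
    "HOL-Computational_Algebra.Polynomial"
    "HOL-Analysis.Complex_Transcendental"
    "Jordan_Normal_Form.Char_Poly"
    "Jordan_Normal_Form.Matrix_Kernel"
begin

(* Only meaningful for nonsingular square matrices. *)
definition minv :: "'a :: field mat \<Rightarrow> 'a mat" where
  "minv A = the (mat_inverse A)"

definition spd_mat :: "nat \<Rightarrow> real mat \<Rightarrow> bool" where
  "spd_mat n A \<longleftrightarrow> A \<in> carrier_mat n n \<and> transpose_mat A = A \<and>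
     (\<forall>v \<in> carrier_vec n. v \<noteq> 0\<^sub>v n \<longrightarrow> v \<bullet> (A *\<^sub>v v) > 0)"

(* The block matrix [A, B^T, 0; B, -D, C^T; 0, C, 0], split after the first block row
   and column: [B; 0] is B @\<^sub>r 0, and [B^T, 0] is its transpose. *)
definition double_saddle_mat ::
  "real mat \<Rightarrow> real mat \<Rightarrow> real mat \<Rightarrow> real mat \<Rightarrow> real mat" where
  "double_saddle_mat A B C D =
     (let B0 = B @\<^sub>r 0\<^sub>m (dim_row C) (dim_col B) in
      four_block_mat
        A   (transpose_mat B0)
        B0  (four_block_mat
               (- D)  (transpose_mat C)
               C      (0\<^sub>m (dim_row C) (dim_row C))))"

(* Eigenvalues are complex and counted with algebraic multiplicity. *)
definition eigenvalues_mset :: "real mat \<Rightarrow> complex multiset" where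
  "eigenvalues_mset M = proots (char_poly (map_mat complex_of_real M))"

(* det (t T - S) as a polynomial in t. *)
definition pencil_poly :: "'a :: comm_ring_1 mat \<Rightarrow> 'a mat \<Rightarrow> 'a poly" where
  "pencil_poly S T =
     det ([:0, 1:] \<cdot>\<^sub>m map_mat (\<lambda>a. [:a:]) T + map_mat (\<lambda>a. [:- a:]) S)"

(* The eigenvalues of S z = t T z for a regular pencil (T nonsingular), with
   multiplicity. *)
definition gen_eigenvalues_mset :: "real mat \<Rightarrow> real mat \<Rightarrow> complex multiset" where
  "gen_eigenvalues_mset S T =
     proots (pencil_poly (map_mat complex_of_real S) (map_mat complex_of_real T))"

end

theory Submission
  imports Defs
begin

text \<open>For \<open>\<lambda> \<noteq> 1\<close> put \<open>\<sigma> = (\<lambda>\<^sup>2 - \<lambda> - 1) / (\<lambda> - 1) = \<lambda> - 1 / (\<lambda> - 1)\<close>. In the pencil \<open>\<lambda> MD - K\<close>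
  the Schur complement of the block \<open>(\<lambda> - 1) A\<close> has leading block \<open>\<sigma> S1\<close>, and eliminating that one
  as well leaves \<open>\<lambda> S2hat - S2 / \<sigma>\<close>. Up to a constant the characteristic polynomial is therefore
  \<open>(\<lambda> - 1)^n \<sigma>^(m - p) \<Prod> (\<lambda> \<sigma> - \<mu>)\<close> for all but finitely many real \<open>\<lambda>\<close>. Multiplying each
  factor \<open>\<lambda> \<sigma> - \<mu>\<close> by one of the factors \<open>\<lambda> - 1\<close> turns it into the cubic of \<open>\<mu>\<close>.
  The value of that cubic is \<open>- 1\<close> at \<open>1\<close> and \<open>\<mu> (1 - \<lambda>)\<close> at the roots of \<open>\<lambda>\<^sup>2 - \<lambda> - 1\<close>,
  and \<open>\<mu> \<noteq> 0\<close> because \<open>S2\<close> is nonsingular, so the multiplicities in (i) and (ii) are exact.\<close>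

section \<open>Inverses, Schur complements and matrix pencils\<close>

lemma minv_props:
  fixes A :: "'a :: field mat"
  assumes A: "A \<in> carrier_mat n n" and d: "det A \<noteq> 0"
  shows "minv A \<in> carrier_mat n n" "A * minv A = 1\<^sub>m n" "minv A * A = 1\<^sub>m n"
proof -
  \<comment> \<open>A nonzero determinant makes \<open>A\<close> a unit, which excludes the result
    \<open>None\<close> of \<open>mat_inverse\<close>.\<close>
  from det_non_zero_imp_unit[OF A d, of "()"] mat_inverse(1)[OF A, of "()"]
  obtain B where "mat_inverse A = Some B" by (cases "mat_inverse A") auto
  with mat_inverse(2)[OF A this]
  show "minv A \<in> carrier_mat n n" "A * minv A = 1\<^sub>m n" "minv A * A = 1\<^sub>m n"
    by (auto simp: minv_def)
qed

lemma invertible_mat_det_nonzero: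
  fixes A :: "'a :: field mat"
  assumes A: "A \<in> carrier_mat n n" and "invertible_mat A"
  shows "det A \<noteq> 0"
proof -
  from assms obtain B where "A * B = 1\<^sub>m n" and "B * A = 1\<^sub>m (dim_row B)"
    by (auto simp: invertible_mat_def inverts_mat_def)
  \<comment> \<open>\<open>inverts_mat\<close> leaves the shape of \<open>B\<close> open; the column
    counts of both products determine it.\<close>
  moreover have "B \<in> carrier_mat n n"
    using arg_cong[OF calculation(1), of dim_col] arg_cong[OF calculation(2), of dim_col] A by auto
  ultimately have "det A * det B = 1"
    using det_mult[OF A, of B] by simp
  then show ?thesis by auto
qed

lemma spd_mat_det_nonzero:
  assumes "spd_mat n A"
  shows "det A \<noteq> 0"
proof
  assume "det A = 0"
  moreover have A: "A \<in> carrier_mat n n" using assms by (simp add: spd_mat_def)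
  ultimately obtain v where v: "v \<in> carrier_vec n" "v \<noteq> 0\<^sub>v n" "A *\<^sub>v v = 0\<^sub>v n"
    using det_0_iff_vec_prod_zero_field by blast
  with assms have "v \<bullet> (A *\<^sub>v v) > 0" unfolding spd_mat_def by blast
  then show False using v by simp
qed

text \<open>Block LU factorization: the unit lower triangular factor built from
  \<open>C * A'\<close> has determinant one, and the other factor is block upper triangular. With
  the left inverse \<open>A'\<close> as a parameter, a scaled inverse can be supplied for a scaled
  block.\<close>

lemma det_four_block_mat_schur:
  fixes A :: "'a :: field mat"
  assumes A: "A \<in> carrier_mat n n" and B: "B \<in> carrier_mat n m"
    and C: "C \<in> carrier_mat m n" and D: "D \<in> carrier_mat m m"
    and A': "A' \<in> carrier_mat n n" and inv: "A' * A = 1\<^sub>m n"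
  shows "det (four_block_mat A B C D) = det A * det (D - C * A' * B)"
proof -
  let ?S = "D - C * A' * B"
  have S: "?S \<in> carrier_mat m m" using assms by auto
  have CA: "C * A' \<in> carrier_mat m n" using C A' by auto
  have "four_block_mat (1\<^sub>m n) (0\<^sub>m n m) (C * A') (1\<^sub>m m) * four_block_mat A B (0\<^sub>m m n) ?S
     = four_block_mat (1\<^sub>m n * A + 0\<^sub>m n m * 0\<^sub>m m n) (1\<^sub>m n * B + 0\<^sub>m n m * ?S)
         (C * A' * A + 1\<^sub>m m * 0\<^sub>m m n) (C * A' * B + 1\<^sub>m m * ?S)"
    by (rule mult_four_block_mat[OF _ _ CA _ A B _ S]) auto
  also have "1\<^sub>m n * A + 0\<^sub>m n m * 0\<^sub>m m n = A" using A by simp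
  also have "1\<^sub>m n * B + 0\<^sub>m n m * ?S = B" using B left_mult_zero_mat[OF S] by simp
  also have "C * A' * A + 1\<^sub>m m * 0\<^sub>m m n = C" using A' A C inv by simp
  also have "C * A' * B + 1\<^sub>m m * ?S = D"
    unfolding left_mult_one_mat[OF S] by (rule eq_matI) (use D CA B in auto)
  finally have "det (four_block_mat A B C D)
     = det (four_block_mat (1\<^sub>m n) (0\<^sub>m n m) (C * A') (1\<^sub>m m)) * det (four_block_mat A B (0\<^sub>m m n) ?S)"
    using det_mult[of "four_block_mat (1\<^sub>m n) (0\<^sub>m n m) (C * A') (1\<^sub>m m)" "n + m"
        "four_block_mat A B (0\<^sub>m m n) ?S"] A S by (metis four_block_carrier_mat one_carrier_mat)
  also have "\<dots> = det A * det ?S"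
    using det_four_block_mat_upper_right_zero[OF one_carrier_mat refl CA one_carrier_mat]
      det_four_block_mat_lower_left_zero[OF A B refl S] by simp
  finally show ?thesis .
qed

lemma poly_pencil_poly:
  assumes S: "S \<in> carrier_mat n n" and T: "T \<in> carrier_mat n n"
  shows "poly (pencil_poly S T) t = det (t \<cdot>\<^sub>m T - S)"
  unfolding pencil_poly_def by (rule poly_det_cong[of _ n]) (use S T in auto)

text \<open>Since t T - S = T (t I - T^-1 S), the two determinants differ by the factor
  \<open>det T\<close>; agreement at every point makes the polynomials equal. The instances are
  \<open>K\<close> with \<open>MD\<close>, for the spectrum, and \<open>S2\<close> with
  \<open>S2hat\<close>, for the \<mu>.\<close>

lemma pencil_poly_eq_char_poly:
  fixes S T :: "'a :: field_char_0 mat"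
  assumes S: "S \<in> carrier_mat n n" and T: "T \<in> carrier_mat n n" and d: "det T \<noteq> 0"
  shows "pencil_poly S T = Polynomial.smult (det T) (char_poly (minv T * S))"
proof -
  note mi = minv_props[OF T d]
  let ?N = "minv T * S"
  have N: "?N \<in> carrier_mat n n" using mi S by auto
  have "poly (Polynomial.smult (det T) (char_poly ?N)) t = poly (pencil_poly S T) t" for t
  proof -
    \<comment> \<open>\<open>char_matrix ?N t\<close> is \<open>?N\<close> minus t times the
      identity, hence the sign.\<close>
    have "T * (- char_matrix ?N t) = T * (t \<cdot>\<^sub>m 1\<^sub>m n - ?N)"
      by (rule arg_cong[of _ _ "\<lambda>X. T * X"], rule eq_matI) (use N mi S in \<open>auto simp: char_matrix_def\<close>)
    also have "\<dots> = T * (t \<cdot>\<^sub>m 1\<^sub>m n) - T * ?N"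
      by (rule mult_minus_distrib_mat[OF T]) (use N in auto)
    also have "T * (t \<cdot>\<^sub>m 1\<^sub>m n) = t \<cdot>\<^sub>m T"
      using mult_smult_distrib[OF T one_carrier_mat] T by simp
    also have "T * ?N = S"
      using assoc_mult_mat[OF T mi(1) S] mi(2) S by simp
    finally have "T * (- char_matrix ?N t) = t \<cdot>\<^sub>m T - S" .
    then have "det (t \<cdot>\<^sub>m T - S) = det T * det (- char_matrix ?N t)"
      using det_mult[OF T, of "- char_matrix ?N t"] N by auto
    then show ?thesis
      using poly_pencil_poly[OF S T] char_poly_matrix[OF N] by simp
  qed
  then show ?thesis by (metis poly_eq_poly_eq_iff ext)
qed

section \<open>One-sided inverses and kernel dimensions\<close>

lemma kernel_basis_of_right_inverse:
  fixes B :: "'a :: field mat"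
  assumes B: "B \<in> carrier_mat m n" and R: "R \<in> carrier_mat n m" and BR: "B * R = 1\<^sub>m m"
  shows "\<exists>X. kernel.basis n B X \<and> finite X \<and> card X = n - m"
proof -
  obtain E where gj: "gauss_jordan_single B = E" by auto
  from gauss_jordan_single[OF B gj]
  obtain P Q where E: "E = P * B" and QP: "Q * P = 1\<^sub>m m"
    and P: "P \<in> carrier_mat m m" and Q: "Q \<in> carrier_mat m m"
    and cE: "E \<in> carrier_mat m n" and row: "row_echelon_form E"
    by auto
  have PQ: "P * Q = 1\<^sub>m m" using mat_mult_left_right_inverse[OF Q P QP] .
  have RQ: "R * Q \<in> carrier_mat n m" using R Q by auto
  \<comment> \<open>Row reduction turns the right inverse \<open>R\<close> of \<open>B\<close> into
    the right inverse \<open>R * Q\<close> of \<open>E\<close>. A zero row of \<open>E\<close> would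
    put a zero on the diagonal of the identity, so all \<open>m\<close> rows are nonzero and the
    echelon form has n - m base vectors.\<close>
  have "E * (R * Q) = P * (B * R) * Q"
    using assoc_mult_mat[OF P B RQ] assoc_mult_mat[OF B R Q] assoc_mult_mat[OF P, of "B * R" m Q m] B R Q E
    by simp
  then have inv: "E * (R * Q) = 1\<^sub>m m" using BR PQ P by simp
  have "row E i \<noteq> 0\<^sub>v n" if i: "i < m" for i
  proof
    assume row: "row E i = 0\<^sub>v n"
    have "col (R * Q) i \<in> carrier_vec n"
      by (rule col_carrier_vec[OF i RQ])
    then have "row E i \<bullet> col (R * Q) i = 0"
      unfolding row by (rule scalar_prod_left_zero)
    moreover have "(E * (R * Q)) $$ (i, i) = row E i \<bullet> col (R * Q) i"
      by (rule index_mult_mat(1)) (use i cE R Q in auto)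
    ultimately have "(E * (R * Q)) $$ (i, i) = 0" by (rule trans[rotated])
    with inv i show False by simp
  qed
  then have "{i. i < m \<and> row E i \<noteq> 0\<^sub>v n} = {..<m}" by auto
  with find_base_vectors(3,4)[OF row cE]
  have "kernel.basis n E (set (find_base_vectors E))" "card (set (find_base_vectors E)) = n - m"
    by simp_all
  moreover have "mat_kernel E = mat_kernel B" unfolding E
    by (rule mat_kernel_mult_eq[OF B P Q QP])
  ultimately show ?thesis by (metis List.finite_set)
qed

text \<open>A left inverse makes the kernel trivial, so the echelon form of \<open>B\<close> has no
  free columns, and its nonzero rows, at most \<open>m\<close> of them, account for all
  \<open>n\<close> columns.\<close>

lemma left_inverse_dim_le:
  fixes B :: "'a :: field mat"
  assumes B: "B \<in> carrier_mat m n" and L: "L \<in> carrier_mat n m" and LB: "L * B = 1\<^sub>m n"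
  shows "n \<le> m"
proof -
  obtain E where gj: "gauss_jordan_single B = E" by auto
  from gauss_jordan_single[OF B gj]
  obtain P Q where E: "E = P * B" and QP: "Q * P = 1\<^sub>m m"
    and P: "P \<in> carrier_mat m m" and Q: "Q \<in> carrier_mat m m"
    and cE: "E \<in> carrier_mat m n" and row: "row_echelon_form E"
    by auto
  have "mat_kernel E = mat_kernel B" unfolding E
    by (rule mat_kernel_mult_eq[OF B P Q QP])
  also have "mat_kernel B \<subseteq> {0\<^sub>v n}"
  proof
    fix v assume "v \<in> mat_kernel B"
    note v = mat_kernelD[OF B this]
    have "v = L * B *\<^sub>v v" using LB v by simp
    also have "\<dots> = L *\<^sub>v (B *\<^sub>v v)" using L B v by simp
    also have "\<dots> = 0\<^sub>v n" using v L by (auto intro!: eq_vecI)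
    finally show "v \<in> {0\<^sub>v n}" by simp
  qed
  \<comment> \<open>Base vectors are nonzero members of the kernel, so there are none. Their number
    is a truncated difference, so its vanishing gives the inequality used next.\<close>
  finally have "set (find_base_vectors E) = {}"
    using find_base_vectors(1,2)[OF row cE] by (metis subset_singletonD subset_trans singletonI)
  then have "n \<le> card {i. i < m \<and> row E i \<noteq> 0\<^sub>v n}"
    using find_base_vectors(4)[OF row cE] by simp
  also have "\<dots> \<le> card {..<m}" by (rule card_mono) auto
  finally show ?thesis by simp
qed

section \<open>Block matrix algebra\<close>

lemma mult_mat_zero_vec:
  fixes X :: "'a :: semiring_0 mat"
  assumes "X \<in> carrier_mat r c"
  shows "X *\<^sub>v 0\<^sub>v c = 0\<^sub>v r"
  by (rule eq_vecI) (use assms in auto)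

lemma smult_inverse_mult_smult:
  fixes X Y :: "'a :: field mat"
  assumes "X \<in> carrier_mat k k" "Y \<in> carrier_mat k k" "X * Y = 1\<^sub>m k" "c \<noteq> 0"
  shows "(1 / c) \<cdot>\<^sub>m X * (c \<cdot>\<^sub>m Y) = 1\<^sub>m k"
proof -
  have "(1 / c) \<cdot>\<^sub>m X * (c \<cdot>\<^sub>m Y) = (1 / c) \<cdot>\<^sub>m (X * (c \<cdot>\<^sub>m Y))"
    by (rule mult_smult_assoc_mat[of _ k k _ k]) (use assms in auto)
  also have "X * (c \<cdot>\<^sub>m Y) = c \<cdot>\<^sub>m 1\<^sub>m k"
    using mult_smult_distrib[OF assms(1,2), of c] assms(3) by metis
  also have "(1 / c) \<cdot>\<^sub>m \<dots> = 1\<^sub>m k"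
    by (rule eq_matI) (use assms(4) in auto)
  finally show ?thesis .
qed

lemma append_rows_mult:
  fixes A :: "'a :: comm_ring_1 mat"
  assumes A: "A \<in> carrier_mat r n" and B: "B \<in> carrier_mat s n" and X: "X \<in> carrier_mat n c"
  shows "(A @\<^sub>r B) * X = (A * X) @\<^sub>r (B * X)"
proof (rule eq_matI)
  fix i j assume "i < dim_row ((A * X) @\<^sub>r (B * X))" "j < dim_col ((A * X) @\<^sub>r (B * X))"
  then have ij: "i < r + s" "j < c" using A B X by (auto simp: append_rows_def)
  have "row (A @\<^sub>r B) i = (if i < r then row A i else row B (i - r))"
    by (rule eq_vecI) (use A B ij in \<open>auto simp: append_rows_def\<close>)
  then show "((A @\<^sub>r B) * X) $$ (i, j) = ((A * X) @\<^sub>r (B * X)) $$ (i, j)"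
    using A B X ij by (auto simp: append_rows_def)
qed (use A B X in \<open>auto simp: append_rows_def\<close>)

text \<open>Two blocks of height zero bring [B^T, 0] into the four-block format that the
  multiplication rules expect.\<close>

lemma transpose_append_zero_rows:
  assumes B: "B \<in> carrier_mat m n"
  shows "transpose_mat (B @\<^sub>r 0\<^sub>m p n)
    = four_block_mat (transpose_mat B) (0\<^sub>m n p) (0\<^sub>m 0 m) (0\<^sub>m 0 p)"
  by (rule eq_matI) (use B in \<open>auto simp: append_rows_def\<close>)

text \<open>The zero rows confine the product to the leading block. For \<open>X = minv A\<close>
  that block is \<open>S1\<close>, so eliminating \<open>A\<close> from the pencil alters none of
  the other blocks.\<close>

lemma append_zero_rows_congruence:
  fixes B X :: "'a :: comm_ring_1 mat"
  assumes B: "B \<in> carrier_mat m n" and X: "X \<in> carrier_mat n n"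
  shows "(B @\<^sub>r 0\<^sub>m p n) * X * transpose_mat (B @\<^sub>r 0\<^sub>m p n)
    = four_block_mat (B * X * transpose_mat B) (0\<^sub>m m p) (0\<^sub>m p m) (0\<^sub>m p p)"
proof -
  have BX: "B * X \<in> carrier_mat m n" using assms by simp
  \<comment> \<open>Likewise, two blocks of width zero make the left factor a four-block
    matrix.\<close>
  have "(B @\<^sub>r 0\<^sub>m p n) * X = four_block_mat (B * X) (0\<^sub>m m 0) (0\<^sub>m p n) (0\<^sub>m p 0)"
    using B X by (subst append_rows_mult[OF B _ X, of _ p]) (auto simp: append_rows_def)
  also have "\<dots> * transpose_mat (B @\<^sub>r 0\<^sub>m p n) =
     four_block_mat (B * X * transpose_mat B + 0\<^sub>m m 0 * 0\<^sub>m 0 m) (B * X * 0\<^sub>m n p + 0\<^sub>m m 0 * 0\<^sub>m 0 p)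
       (0\<^sub>m p n * transpose_mat B + 0\<^sub>m p 0 * 0\<^sub>m 0 m) (0\<^sub>m p n * 0\<^sub>m n p + 0\<^sub>m p 0 * 0\<^sub>m 0 p)"
    unfolding transpose_append_zero_rows[OF B]
    by (rule mult_four_block_mat[OF BX]) (use B in auto)
  also have "\<dots> = four_block_mat (B * X * transpose_mat B) (0\<^sub>m m p) (0\<^sub>m p m) (0\<^sub>m p p)"
    using B BX by (auto intro!: cong_four_block_mat)
  finally show ?thesis .
qed

text \<open>The off-diagonal blocks of \<lambda> \<open>MD\<close> - \<open>K\<close> carry minus
  signs; in a Schur complement these cancel, and the scalar of the inverse moves out.\<close>

lemma uminus_mult_mult_uminus:
  fixes X Y Z :: "'a :: comm_ring_1 mat"
  assumes "X \<in> carrier_mat a b" "Y \<in> carrier_mat b c" "Z \<in> carrier_mat c d"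
  shows "(- X) * (k \<cdot>\<^sub>m Y) * (- Z) = k \<cdot>\<^sub>m (X * Y * Z)"
proof -
  have "(- X) * (k \<cdot>\<^sub>m Y) = - (X * (k \<cdot>\<^sub>m Y))"
    using uminus_mult_left_mat[of X "k \<cdot>\<^sub>m Y"] assms by auto
  also have "X * (k \<cdot>\<^sub>m Y) = k \<cdot>\<^sub>m (X * Y)" using mult_smult_distrib[OF assms(1,2)] .
  also have "- (k \<cdot>\<^sub>m (X * Y)) * (- Z) = (k \<cdot>\<^sub>m (X * Y)) * Z"
    using assms uminus_mult_left_mat[of "k \<cdot>\<^sub>m (X * Y)" "- Z"]
      uminus_mult_right_mat[of "k \<cdot>\<^sub>m (X * Y)" Z] by auto
  also have "\<dots> = k \<cdot>\<^sub>m (X * Y * Z)"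
    by (rule mult_smult_assoc_mat[of _ a c _ d]) (use assms in auto)
  finally show ?thesis .
qed

section \<open>The double saddle point matrix and its pencil\<close>

text \<open>\<open>T\<close> stands for \<open>S2hat\<close>.\<close>

locale double_saddle =
  fixes n m p :: nat and A B C S1 S2 T :: "real mat"
  assumes A: "A \<in> carrier_mat n n" and B: "B \<in> carrier_mat m n" and C: "C \<in> carrier_mat p m"
    and T: "T \<in> carrier_mat p p"
    and S1_eq: "S1 = B * minv A * transpose_mat B"
    and S2_eq: "S2 = C * minv S1 * transpose_mat C"
    and det_A: "det A \<noteq> 0" and det_S1: "det S1 \<noteq> 0" and det_S2: "det S2 \<noteq> 0" and det_T: "det T \<noteq> 0"
begin

definition K where "K = double_saddle_mat A B C (0\<^sub>m m m)"
definition MD where "MD = diag_block_mat [A, S1, T]"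
definition N where "N = minv MD * K"

lemmas A_inv = minv_props[OF A det_A]

lemma S1: "S1 \<in> carrier_mat m m"
  using A_inv B by (simp add: S1_eq)

lemmas S1_inv = minv_props[OF S1 det_S1]

lemma S2: "S2 \<in> carrier_mat p p"
  using S1_inv C by (simp add: S2_eq)

lemma K_eq: "K = four_block_mat A (transpose_mat (B @\<^sub>r 0\<^sub>m p n)) (B @\<^sub>r 0\<^sub>m p n)
    (four_block_mat (0\<^sub>m m m) (transpose_mat C) C (0\<^sub>m p p))"
proof -
  have "- 0\<^sub>m m m = (0\<^sub>m m m :: real mat)" by (rule eq_matI) auto
  then show ?thesis using B C by (simp add: K_def double_saddle_mat_def Let_def)
qed

lemma MD_eq: "MD = four_block_mat A (0\<^sub>m n (m + p)) (0\<^sub>m (m + p) n)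
    (four_block_mat S1 (0\<^sub>m m p) (0\<^sub>m p m) T)"
proof -
  have "diag_block_mat [S1, T] = four_block_mat S1 (0\<^sub>m m p) (0\<^sub>m p m) T"
    using S1 T diag_block_mat_singleton[of T]
    by (subst diag_block_mat.simps(2)) (simp only: Let_def, simp)
  then have "MD = four_block_mat A (0\<^sub>m (dim_row A) (m + p)) (0\<^sub>m (m + p) (dim_col A))
    (four_block_mat S1 (0\<^sub>m m p) (0\<^sub>m p m) T)"
    using S1 T unfolding MD_def by (subst diag_block_mat.simps(2)) (simp only: Let_def, simp)
  then show ?thesis using A by simp
qed

lemma K: "K \<in> carrier_mat (n + (m + p)) (n + (m + p))"
  unfolding K_eq using A C by (intro four_block_carrier_mat) auto

lemma MD: "MD \<in> carrier_mat (n + (m + p)) (n + (m + p))"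
  unfolding MD_eq using A S1 T by (intro four_block_carrier_mat) auto

lemma det_MD: "det MD = det A * det S1 * det T"
proof -
  have ST: "four_block_mat S1 (0\<^sub>m m p) (0\<^sub>m p m) T \<in> carrier_mat (m + p) (m + p)"
    using S1 T by auto
  show ?thesis unfolding MD_eq
    using det_four_block_mat_lower_left_zero[OF A _ refl ST, of "0\<^sub>m n (m + p)"]
      det_four_block_mat_lower_left_zero[OF S1 _ refl T, of "0\<^sub>m m p"] by simp
qed

lemma det_MD_nonzero: "det MD \<noteq> 0"
  using det_A det_S1 det_T by (simp add: det_MD)

lemmas MD_inv = minv_props[OF MD det_MD_nonzero]

lemma N: "N \<in> carrier_mat (n + (m + p)) (n + (m + p))"
  using MD_inv K by (simp add: N_def)

text \<open>The product \<open>C * minv S1 * transpose_mat C\<close> is \<open>S2\<close>, so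
  nonsingularity of \<open>S2\<close> gives \<open>C\<close> full row rank. This yields p \<le>
  m.\<close>

lemma C_right_inverse: "C * (minv S1 * transpose_mat C * minv S2) = 1\<^sub>m p"
proof -
  note S2_inv = minv_props[OF S2 det_S2]
  have "C * (minv S1 * transpose_mat C * minv S2) = C * (minv S1 * transpose_mat C) * minv S2"
    using C S1_inv S2_inv by (subst assoc_mult_mat) auto
  also have "C * (minv S1 * transpose_mat C) = S2"
    unfolding S2_eq using C S1_inv by (subst assoc_mult_mat) auto
  finally show ?thesis using S2_inv by simp
qed

text \<open>The same with \<open>S1\<close> in place of \<open>S2\<close>; full row rank of
  \<open>B\<close> gives its kernel the dimension n - m.\<close>

lemma B_right_inverse: "B * (minv A * transpose_mat B * minv S1) = 1\<^sub>m m"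
proof -
  have "B * (minv A * transpose_mat B * minv S1) = B * (minv A * transpose_mat B) * minv S1"
    using B A_inv S1_inv by (subst assoc_mult_mat) auto
  also have "B * (minv A * transpose_mat B) = S1"
    unfolding S1_eq using B A_inv by (subst assoc_mult_mat) auto
  finally show ?thesis using S1_inv by simp
qed

lemma p_le_m: "p \<le> m"
  \<comment> \<open>The equation is read from the other side: \<open>C\<close> serves as the left
    inverse of an m by p matrix.\<close>
  by (rule left_inverse_dim_le[OF _ C C_right_inverse])
    (use C S1_inv minv_props[OF S2 det_S2] in auto)

text \<open>\<open>S1\<close> ends in the factor \<open>transpose_mat B\<close>, so a null vector of
  that factor is a null vector of the nonsingular \<open>S1\<close>.\<close>

lemma transpose_B_kernel:
  assumes y: "y \<in> carrier_vec m" and "transpose_mat B *\<^sub>v y = 0\<^sub>v n"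
  shows "y = 0\<^sub>v m"
proof -
  have "S1 *\<^sub>v y = B * minv A *\<^sub>v (transpose_mat B *\<^sub>v y)"
    unfolding S1_eq using B A_inv y by (intro assoc_mult_mat_vec) auto
  also have "\<dots> = 0\<^sub>v m"
    unfolding assms(2) by (rule mult_mat_zero_vec) (use B A_inv in auto)
  finally show ?thesis
    using det_0_iff_vec_prod_zero_field[OF S1] det_S1 y by blast
qed

lemma transpose_C_kernel:
  assumes z: "z \<in> carrier_vec p" and "transpose_mat C *\<^sub>v z = 0\<^sub>v m"
  shows "z = 0\<^sub>v p"
proof -
  have "S2 *\<^sub>v z = C * minv S1 *\<^sub>v (transpose_mat C *\<^sub>v z)"
    unfolding S2_eq using C S1_inv z by (intro assoc_mult_mat_vec) auto
  also have "\<dots> = 0\<^sub>v p"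
    unfolding assms(2) by (rule mult_mat_zero_vec) (use C S1_inv in auto)
  finally show ?thesis
    using det_0_iff_vec_prod_zero_field[OF S2] det_S2 z by blast
qed

lemma det_pencil:
  assumes l: "l \<noteq> 1" and s: "s * (l - 1) = l\<^sup>2 - l - 1" "s \<noteq> 0"
  shows "det (l \<cdot>\<^sub>m MD - K) = (l - 1) ^ n * det A * (s ^ m * det S1) * det (l \<cdot>\<^sub>m T - (1 / s) \<cdot>\<^sub>m S2)"
proof -
  let ?B0 = "B @\<^sub>r 0\<^sub>m p n"
  let ?E = "four_block_mat (l \<cdot>\<^sub>m S1) (- transpose_mat C) (- C) (l \<cdot>\<^sub>m T)"
  have B0: "?B0 \<in> carrier_mat (m + p) n" using B by auto
  have E: "?E \<in> carrier_mat (m + p) (m + p)" using S1 T by auto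
  have inv: "(1 / (l - 1)) \<cdot>\<^sub>m minv A * ((l - 1) \<cdot>\<^sub>m A) = 1\<^sub>m n"
    by (rule smult_inverse_mult_smult) (use A A_inv l in auto)
  have inv': "(1 / s) \<cdot>\<^sub>m minv S1 * (s \<cdot>\<^sub>m S1) = 1\<^sub>m m"
    by (rule smult_inverse_mult_smult) (use S1 S1_inv s in auto)
  have "l \<cdot>\<^sub>m MD - K = four_block_mat ((l - 1) \<cdot>\<^sub>m A) (- transpose_mat ?B0) (- ?B0) ?E"
    unfolding MD_eq K_eq
    by (rule eq_matI) (use A B0 C S1 T in \<open>auto simp: algebra_simps\<close>)
  also have "det \<dots> = det ((l - 1) \<cdot>\<^sub>m A) *
      det (?E - (- ?B0) * ((1 / (l - 1)) \<cdot>\<^sub>m minv A) * (- transpose_mat ?B0))"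
    by (rule det_four_block_mat_schur[OF _ _ _ E _ inv]) (use A A_inv B0 in auto)
  also have "(- ?B0) * ((1 / (l - 1)) \<cdot>\<^sub>m minv A) * (- transpose_mat ?B0)
      = (1 / (l - 1)) \<cdot>\<^sub>m four_block_mat S1 (0\<^sub>m m p) (0\<^sub>m p m) (0\<^sub>m p p)"
    using uminus_mult_mult_uminus[OF B0 A_inv(1), of "transpose_mat ?B0" "m + p"] B0
      append_zero_rows_congruence[OF B A_inv(1), of p] by (simp add: S1_eq)
  \<comment> \<open>Only the leading block changes, and its coefficient \<lambda> - 1 / (\<lambda> -
    1) is \<open>s\<close>.\<close>
  also have "?E - \<dots> = four_block_mat (s \<cdot>\<^sub>m S1) (- transpose_mat C) (- C) (l \<cdot>\<^sub>m T)"
  proof -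
    have "s = l - 1 / (l - 1)" using s l by (simp add: field_simps power2_eq_square)
    then show ?thesis
      by (intro eq_matI) (use C S1 T in \<open>auto simp: left_diff_distrib\<close>)
  qed
  \<comment> \<open>Second elimination, with pivot \<open>s \<cdot>\<^sub>m S1\<close>; its inverse
    requires \<open>s\<close> to be nonzero.\<close>
  also have "det \<dots> = det (s \<cdot>\<^sub>m S1) *
      det (l \<cdot>\<^sub>m T - (- C) * ((1 / s) \<cdot>\<^sub>m minv S1) * (- transpose_mat C))"
    by (rule det_four_block_mat_schur[OF _ _ _ _ _ inv']) (use S1 S1_inv C T in auto)
  also have "(- C) * ((1 / s) \<cdot>\<^sub>m minv S1) * (- transpose_mat C) = (1 / s) \<cdot>\<^sub>m S2"
    using uminus_mult_mult_uminus[OF C S1_inv(1), of "transpose_mat C" p] C by (simp add: S2_eq)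
  finally show ?thesis using A S1 by (simp add: mult.assoc)
qed

text \<open>This belongs to S2 z = \<mu> T z in the form T^-1 S2 z = \<mu> z. It stays over the
  reals, where the determinants are computed; its complex roots are the \<mu>.\<close>

definition char_S2 where "char_S2 = char_poly (minv T * S2)"

text \<open>Both pencils are normalised, by \<open>det MD\<close> and by \<open>det T\<close>.
  Pulling 1 / s out of the p by p determinant lowers the exponent of s from m to m - p and moves the
  evaluation point to \<lambda> s.\<close>

lemma poly_char_poly_N:
  assumes l: "l \<noteq> 1" and s: "s * (l - 1) = l\<^sup>2 - l - 1" "s \<noteq> 0"
  shows "poly (char_poly N) l = (l - 1) ^ n * s ^ (m - p) * poly char_S2 (l * s)"
proof -
  have "det MD * poly (char_poly N) l = det (l \<cdot>\<^sub>m MD - K)"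
    using pencil_poly_eq_char_poly[OF K MD det_MD_nonzero] poly_pencil_poly[OF K MD, of l]
    by (simp add: N_def)
  also have "\<dots> = (l - 1) ^ n * det A * (s ^ m * det S1) * det (l \<cdot>\<^sub>m T - (1 / s) \<cdot>\<^sub>m S2)"
    by (rule det_pencil[OF l s])
  also have "l \<cdot>\<^sub>m T - (1 / s) \<cdot>\<^sub>m S2 = (1 / s) \<cdot>\<^sub>m ((l * s) \<cdot>\<^sub>m T - S2)"
    by (rule eq_matI) (use T S2 s in \<open>auto simp: field_simps\<close>)
  also have "det \<dots> = (1 / s) ^ p * det ((l * s) \<cdot>\<^sub>m T - S2)"
    using T S2 by simp
  also have "det ((l * s) \<cdot>\<^sub>m T - S2) = det T * poly char_S2 (l * s)"
    using pencil_poly_eq_char_poly[OF S2 T det_T] poly_pencil_poly[OF S2 T, of "l * s"]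
    by (simp add: char_S2_def)
  \<comment> \<open>\<open>p_le_m\<close> keeps the difference of natural numbers from
    truncating.\<close>
  also have "s ^ m = s ^ (m - p) * s ^ p" using p_le_m by (simp flip: power_add)
  finally show ?thesis
    using det_A det_S1 det_T s by (simp add: det_MD field_simps)
qed

end

section \<open>Factorization of the characteristic polynomial over the complex numbers\<close>

lemma poly_eqI_cofinite:
  fixes P Q :: "complex poly"
  assumes fin: "finite F" and eq: "\<And>l :: real. l \<notin> F \<Longrightarrow> poly P (of_real l) = poly Q (of_real l)"
  shows "P = Q"
proof (rule ccontr)
  assume "P \<noteq> Q"
  then have "finite {z. poly (P - Q) z = 0}" by (intro poly_roots_finite) simp
  \<comment> \<open>The real line outside \<open>F\<close> embeds into the root set of a nonzero
    polynomial, which is impossible because that set is finite.\<close>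
  moreover have "complex_of_real ` (- F) \<subseteq> {z. poly (P - Q) z = 0}" using eq by auto
  ultimately have "finite (complex_of_real ` (- F))" by (rule finite_subset[rotated])
  then have "finite (- F)" by (rule finite_imageD) (auto simp: inj_on_def)
  with fin show False by (metis Compl_eq_Diff_UNIV Diff_infinite_finite infinite_UNIV_char_0)
qed

text \<open>Used to hand one copy of \<lambda> - 1 to each factor belonging to a \<mu>.\<close>

lemma power_size_mult_prod_mset:
  fixes a :: "'a :: comm_monoid_mult"
  shows "a ^ size M * (\<Prod>x\<in>#M. f x) = (\<Prod>x\<in>#M. a * f x)"
  by (induction M) (auto simp: ac_simps)

lemma poly_map_poly_complex_of_real:
  "poly (map_poly complex_of_real P) (complex_of_real x) = complex_of_real (poly P x)"
  by (rule of_real_hom.poly_map_poly)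

lemma poly_prod_mset_image:
  "poly (\<Prod>x\<in>#M. f x) z = (\<Prod>x\<in>#M. poly (f x) z)"
  by (induction M) auto

lemma golden_root:
  assumes "l = (1 + sqrt 5) / 2 \<or> l = (1 - sqrt 5) / 2"
  shows "l\<^sup>2 = l + 1"
  using assms by (elim disjE; hypsubst) (simp_all add: power2_eq_square field_simps)

context double_saddle
begin

definition mus :: "complex multiset" where "mus = gen_eigenvalues_mset S2 T"

abbreviation (input) cubic :: "complex \<Rightarrow> complex poly" where
  "cubic \<mu> \<equiv> [:\<mu>, - (1 + \<mu>), - 1, 1:]"

lemma H: "minv T * S2 \<in> carrier_mat p p"
  using minv_props[OF T det_T] S2 by simp

text \<open>Embedding the entries into the complex numbers commutes with the determinant, and the
  nonzero constant \<open>det T\<close> does not affect the roots.\<close>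

lemma mus_eq: "mus = proots (map_poly complex_of_real char_S2)"
proof -
  have "pencil_poly (map_mat complex_of_real S2) (map_mat complex_of_real T)
      = map_poly complex_of_real (pencil_poly S2 T)"
  proof -
    interpret map_poly_hom: map_poly_comm_ring_hom complex_of_real ..
    have "[:0, 1:] \<cdot>\<^sub>m map_mat (\<lambda>a. [:a:]) (map_mat complex_of_real T)
          + map_mat (\<lambda>a. [:- a:]) (map_mat complex_of_real S2)
        = map_mat (map_poly complex_of_real)
          ([:0, 1:] \<cdot>\<^sub>m map_mat (\<lambda>a. [:a:]) T + map_mat (\<lambda>a. [:- a:]) S2)"
      by (rule eq_matI) (use S2 T in \<open>auto simp: hom_distribs\<close>)
    then show ?thesis unfolding pencil_poly_def by (simp add: map_poly_hom.hom_det)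
  qed
  also have "\<dots> = Polynomial.smult (complex_of_real (det T)) (map_poly complex_of_real char_S2)"
    unfolding pencil_poly_eq_char_poly[OF S2 T det_T] char_S2_def by (simp add: hom_distribs)
  finally show ?thesis unfolding mus_def gen_eigenvalues_mset_def using det_T by simp
qed

lemma size_mus: "size mus = p"
  unfolding mus_eq size_proots_complex char_S2_def
  using degree_monic_char_poly[OF H] by simp

lemma char_S2_decompose: "map_poly complex_of_real char_S2 = (\<Prod>\<mu>\<in>#mus. [:- \<mu>, 1:])"
proof -
  have "lead_coeff (map_poly complex_of_real char_S2) = 1"
    using degree_monic_char_poly[OF H] by (simp add: char_S2_def)
  then show ?thesis
    using complex_poly_decompose_multiset[of "map_poly complex_of_real char_S2"]
    by (simp add: mus_eq)
qed

text \<open>A zero \<mu> would make the pencil vanish at 0, where its value is the determinant of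
  -\<open>S2\<close>. The exact multiplicity of the golden roots rests on this.\<close>

lemma zero_notin_mus: "0 \<notin># mus"
proof
  assume "0 \<in># mus"
  moreover have "map_poly complex_of_real char_S2 \<noteq> 0"
    using degree_monic_char_poly[OF H] by (auto simp: char_S2_def)
  ultimately have "poly (map_poly complex_of_real char_S2) 0 = 0"
    unfolding mus_eq by (metis mem_Collect_eq set_count_proots)
  then have "poly char_S2 0 = 0"
    using poly_map_poly_complex_of_real[of char_S2 0] by simp
  then have "det (0 \<cdot>\<^sub>m T - S2) = 0"
    using poly_pencil_poly[OF S2 T, of 0] pencil_poly_eq_char_poly[OF S2 T det_T]
    by (simp add: char_S2_def)
  moreover have "0 \<cdot>\<^sub>m T - S2 = - S2"
    by (rule eq_matI) (use S2 T in auto)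
  ultimately have "det (- S2) = 0" by (simp only:)
  then show False using det_S2 det_0_negate[OF S2] by simp
qed

text \<open>The factored form expected of the characteristic polynomial of \<open>N\<close>. The
  quadratic is \<lambda>^2 - \<lambda> - 1, and the degrees add up to (n - m) + 2 (m - p) + 3 p = n
  + m + p.\<close>

definition R :: "complex poly" where
  "R = [:- 1, 1:] ^ (n - m) * [:- 1, - 1, 1:] ^ (m - p) * (\<Prod>\<mu>\<in>#mus. cubic \<mu>)"

lemma char_poly_N_factorization:
  assumes mn: "m \<le> n"
  shows "map_poly complex_of_real (char_poly N) = R"
proof (rule poly_eqI_cofinite)
  \<comment> \<open>The excluded points are the pole of \<sigma> and its two zeros, where one of the
    pivots is singular or \<sigma> is undefined.\<close>
  show "finite ({1, (1 + sqrt 5) / 2, (1 - sqrt 5) / 2} :: real set)" by simp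
  fix l :: real
  assume l: "l \<notin> {1, (1 + sqrt 5) / 2, (1 - sqrt 5) / 2}"
  have "l\<^sup>2 - l - 1 = (l - (1 + sqrt 5) / 2) * (l - (1 - sqrt 5) / 2)"
    by (simp add: power2_eq_square field_simps)
  with l have nz: "l\<^sup>2 - l - 1 \<noteq> 0" by auto
  define s where "s = (l\<^sup>2 - l - 1) / (l - 1)"
  have s: "s * (l - 1) = l\<^sup>2 - l - 1" "s \<noteq> 0" using l nz by (auto simp: s_def)
  let ?l = "complex_of_real l" and ?s = "complex_of_real s"
  have cs: "?s * (?l - 1) = ?l\<^sup>2 - ?l - 1"
    using arg_cong[OF s(1), of complex_of_real] by simp
  have "poly (map_poly complex_of_real (char_poly N)) ?l
      = (?l - 1) ^ n * ?s ^ (m - p) * poly (map_poly complex_of_real char_S2) (?l * ?s)"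
    using poly_char_poly_N[of l s] l s poly_map_poly_complex_of_real[of char_S2 "l * s"]
    by (simp add: poly_map_poly_complex_of_real)
  \<comment> \<open>Of these copies, m - p clear the denominators of \<open>?s ^ (m - p)\<close>,
    one goes to each of the \<open>p\<close> cubics, and n - m remain.\<close>
  also have "(?l - 1) ^ n = (?l - 1) ^ (n - m) * (?l - 1) ^ (m - p) * (?l - 1) ^ size mus"
    using mn p_le_m by (simp add: size_mus flip: power_add)
  also have "poly (map_poly complex_of_real char_S2) (?l * ?s) = (\<Prod>\<mu>\<in>#mus. ?l * ?s - \<mu>)"
    by (simp add: char_S2_decompose poly_prod_mset_image)
  also have "(?l - 1) ^ (n - m) * (?l - 1) ^ (m - p) * (?l - 1) ^ size mus * ?s ^ (m - p)
        * (\<Prod>\<mu>\<in>#mus. ?l * ?s - \<mu>)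
      = (?l - 1) ^ (n - m) * (?s * (?l - 1)) ^ (m - p) * (\<Prod>\<mu>\<in>#mus. (?l - 1) * (?l * ?s - \<mu>))"
    by (simp add: power_mult_distrib mult_ac flip: power_size_mult_prod_mset)
  \<comment> \<open>Since s (\<lambda> - 1) = \<lambda>^2 - \<lambda> - 1, the product is \<lambda>
    (\<lambda>^2 - \<lambda> - 1) - \<mu> (\<lambda> - 1), which is the cubic.\<close>
  also have "(\<lambda>\<mu>. (?l - 1) * (?l * ?s - \<mu>)) = (\<lambda>\<mu>. poly (cubic \<mu>) ?l)"
  proof
    fix \<mu>
    have "(?l - 1) * (?l * ?s - \<mu>) = ?l * (?s * (?l - 1)) - (?l - 1) * \<mu>"
      by (simp add: algebra_simps)
    then show "(?l - 1) * (?l * ?s - \<mu>) = poly (cubic \<mu>) ?l"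
      unfolding cs by (simp add: algebra_simps power2_eq_square)
  qed
  also have "?s * (?l - 1) = poly [:- 1, - 1, 1:] ?l"
    unfolding cs by (simp add: algebra_simps power2_eq_square)
  finally show "poly (map_poly complex_of_real (char_poly N)) ?l = poly R ?l"
    by (simp add: R_def poly_prod_mset_image)
qed

lemma proots_R:
  "proots R = replicate_mset (n - m) 1
     + replicate_mset (m - p) (complex_of_real ((1 + sqrt 5) / 2))
     + replicate_mset (m - p) (complex_of_real ((1 - sqrt 5) / 2))
     + (\<Sum>\<mu>\<in>#mus. proots (cubic \<mu>))"
proof -
  let ?a = "complex_of_real ((1 + sqrt 5) / 2)" and ?b = "complex_of_real ((1 - sqrt 5) / 2)"
  \<comment> \<open>Sum 1 and product -1 identify the two numbers as the roots of \<lambda>^2 -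
    \<lambda> - 1.\<close>
  have "?a + ?b = 1" "?a * ?b = - 1"
    by (simp_all only: of_real_add[symmetric] of_real_mult[symmetric]) (simp_all add: field_simps)
  moreover have "[:- ?a, 1:] * [:- ?b, 1:] = [:?a * ?b, - (?a + ?b), 1:]"
    by simp
  ultimately have "[:- 1, - 1, 1:] = [:- ?a, 1:] * [:- ?b, 1:]"
    by (simp only:)
  then have golden: "proots [:- 1, - 1, 1 :: complex:] = {#?a, ?b#}"
    using proots_mult[of "[:- ?a, 1:]" "[:- ?b, 1:]"] by (simp only: proots_linear_factor) simp
  \<comment> \<open>\<open>proots_power\<close> repeats the pair of roots as a whole, while the goal
    counts the two roots separately.\<close>
  have rep: "repeat_mset k {#a, b#} = replicate_mset k a + replicate_mset k b" for k and a b :: complex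
    by (rule multiset_eqI) auto
  have nz: "(\<Prod>\<mu>\<in>#mus. cubic \<mu>) \<noteq> 0"
    by (simp add: prod_mset_zero_iff image_iff)
  have "proots (\<Prod>\<mu>\<in>#mus. cubic \<mu>) = (\<Sum>\<mu>\<in>#mus. proots (cubic \<mu>))"
    using proots_prod_mset[of "image_mset cubic mus"] by (simp add: image_iff image_mset.compositionality comp_def)
  with nz show ?thesis
    by (simp add: R_def proots_mult proots_power golden rep)
qed

text \<open>Embedding the real characteristic polynomial into the complex numbers preserves root
  orders, so the order of a real root can be read off the complex root multiset.\<close>

lemma order_char_poly_N:
  assumes mn: "m \<le> n"
  shows "Polynomial.order l (char_poly N) = count (proots R) (complex_of_real l)"
proof -
  have "char_poly N \<noteq> 0" using degree_monic_char_poly[OF N] by auto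
  then have nz: "map_poly complex_of_real (char_poly N) \<noteq> 0" by simp
  interpret map_poly_inj_idom_divide_hom complex_of_real ..
  show ?thesis
    using nz order_hom[of l "char_poly N"] by (simp flip: char_poly_N_factorization[OF mn])
qed

text \<open>Disjointness from the other families of roots reduces to evaluating the cubics; their
  roots need not be known.\<close>

lemma count_cubics:
  assumes "\<And>\<mu>. \<mu> \<in># mus \<Longrightarrow> poly (cubic \<mu>) z \<noteq> 0"
  shows "count (\<Sum>\<mu>\<in>#mus. proots (cubic \<mu>)) z = 0"
proof -
  have "z \<notin># (\<Sum>\<mu>\<in>#mus. proots (cubic \<mu>))" using assms by auto
  then show ?thesis by (simp only: not_in_iff)
qed

end

section \<open>Eigenvectors in block form\<close>

lemma smult_append_vec:
  "c \<cdot>\<^sub>v (v @\<^sub>v w) = (c \<cdot>\<^sub>v v) @\<^sub>v (c \<cdot>\<^sub>v w)"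
  by (rule eq_vecI) auto

lemma zero_vec_append: "0\<^sub>v (a + b) = 0\<^sub>v a @\<^sub>v 0\<^sub>v b"
  by (rule eq_vecI) auto

lemma append_vec_cases:
  assumes "v \<in> carrier_vec (a + b)"
  obtains x y where "x \<in> carrier_vec a" "y \<in> carrier_vec b" "v = x @\<^sub>v y"
  by (metis assms vec_first_carrier vec_first_last_append vec_last_carrier)

lemma vec_add_right_cancel_zero:
  fixes u w :: "'a :: ring vec"
  assumes "u \<in> carrier_vec k" "w \<in> carrier_vec k"
  shows "u + w = u \<longleftrightarrow> w = 0\<^sub>v k"
proof
  assume eq: "u + w = u"
  show "w = 0\<^sub>v k"
  proof (rule eq_vecI)
    fix i assume "i < dim_vec (0\<^sub>v k :: 'a vec)"
    then show "w $ i = 0\<^sub>v k $ i" using arg_cong[OF eq, of "\<lambda>v. v $ i"] assms by simp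
  qed (use assms in auto)
qed (use assms in auto)

lemma vec_add_eq_smult_iff:
  fixes u w :: "'a :: field vec"
  assumes "u \<in> carrier_vec k" "w \<in> carrier_vec k" "l \<noteq> 1"
  shows "u + w = l \<cdot>\<^sub>v u \<longleftrightarrow> u = (1 / (l - 1)) \<cdot>\<^sub>v w"
proof -
  have "a + b = l * a \<longleftrightarrow> a = (1 / (l - 1)) * b" for a b :: 'a
    using assms(3) by (auto simp: field_simps)
  then show ?thesis using assms(1,2) by (auto simp: vec_eq_iff)
qed

context double_saddle
begin

lemma K_mult_vec:
  assumes x: "x \<in> carrier_vec n" and y: "y \<in> carrier_vec m" and z: "z \<in> carrier_vec p"
  shows "K *\<^sub>v (x @\<^sub>v y @\<^sub>v z)
    = (A *\<^sub>v x + transpose_mat B *\<^sub>v y) @\<^sub>v (B *\<^sub>v x + transpose_mat C *\<^sub>v z) @\<^sub>v (C *\<^sub>v y)"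
proof -
  let ?B0 = "B @\<^sub>r 0\<^sub>m p n"
  let ?E = "four_block_mat (0\<^sub>m m m) (transpose_mat C) C (0\<^sub>m p p)"
  have B0: "?B0 \<in> carrier_mat (m + p) n" using B by auto
  have E: "?E \<in> carrier_mat (m + p) (m + p)" by (rule four_block_carrier_mat) auto
  have yz: "y @\<^sub>v z \<in> carrier_vec (m + p)" using y z by auto
  have "K *\<^sub>v (x @\<^sub>v y @\<^sub>v z) = (A *\<^sub>v x + transpose_mat ?B0 *\<^sub>v (y @\<^sub>v z))
      @\<^sub>v (?B0 *\<^sub>v x + ?E *\<^sub>v (y @\<^sub>v z))"
    unfolding K_eq by (rule four_block_mat_mult_vec[OF A _ B0 E x yz]) (use B0 in auto)
  also have "transpose_mat ?B0 *\<^sub>v (y @\<^sub>v z)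
      = (transpose_mat B *\<^sub>v y + 0\<^sub>m n p *\<^sub>v z) @\<^sub>v (0\<^sub>m 0 m *\<^sub>v y + 0\<^sub>m 0 p *\<^sub>v z)"
    unfolding transpose_append_zero_rows[OF B]
    by (rule four_block_mat_mult_vec[OF _ _ _ _ y z]) (use B in auto)
  \<comment> \<open>The second half has height zero and disappears.\<close>
  also have "\<dots> = transpose_mat B *\<^sub>v y"
    by (rule eq_vecI) (use B y z in auto)
  also have "?B0 *\<^sub>v x = (B *\<^sub>v x) @\<^sub>v 0\<^sub>v p"
  proof -
    have "0\<^sub>m p n *\<^sub>v x = 0\<^sub>v p" by (rule eq_vecI) (use x in auto)
    then show ?thesis using mat_mult_append[OF B zero_carrier_mat[of p n] x] by simp
  qed
  also have "?E *\<^sub>v (y @\<^sub>v z) = (0\<^sub>m m m *\<^sub>v y + transpose_mat C *\<^sub>v z) @\<^sub>v (C *\<^sub>v y + 0\<^sub>m p p *\<^sub>v z)"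
    by (rule four_block_mat_mult_vec[OF _ _ _ _ y z]) (use C in auto)
  also have "((B *\<^sub>v x) @\<^sub>v 0\<^sub>v p) + (\<dots>) = (B *\<^sub>v x + transpose_mat C *\<^sub>v z) @\<^sub>v (C *\<^sub>v y)"
    by (rule eq_vecI) (use B C x y z in auto)
  finally show ?thesis .
qed

lemma MD_mult_vec:
  assumes x: "x \<in> carrier_vec n" and y: "y \<in> carrier_vec m" and z: "z \<in> carrier_vec p"
  shows "MD *\<^sub>v (x @\<^sub>v y @\<^sub>v z) = (A *\<^sub>v x) @\<^sub>v (S1 *\<^sub>v y) @\<^sub>v (T *\<^sub>v z)"
proof -
  have ST: "four_block_mat S1 (0\<^sub>m m p) (0\<^sub>m p m) T \<in> carrier_mat (m + p) (m + p)"
    using S1 T by auto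
  have yz: "y @\<^sub>v z \<in> carrier_vec (m + p)" using y z by auto
  show ?thesis
    unfolding MD_eq using mult_mat_vec_split[OF A ST x yz] mult_mat_vec_split[OF S1 T y z] by simp
qed

text \<open>Passing to the pencil removes \<open>minv MD\<close>, so that only products of block
  matrices with block vectors remain.\<close>

lemma N_mult_vec_iff:
  assumes v: "v \<in> carrier_vec (n + (m + p))"
  shows "N *\<^sub>v v = l \<cdot>\<^sub>v v \<longleftrightarrow> K *\<^sub>v v = l \<cdot>\<^sub>v (MD *\<^sub>v v)"
proof
  have Kv: "K *\<^sub>v v \<in> carrier_vec (n + (m + p))" using K v by auto
  have N_eq: "N *\<^sub>v v = minv MD *\<^sub>v (K *\<^sub>v v)"
    unfolding N_def using MD_inv(1) K v by (rule assoc_mult_mat_vec)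
  {
    assume "N *\<^sub>v v = l \<cdot>\<^sub>v v"
    then have "MD *\<^sub>v (minv MD *\<^sub>v (K *\<^sub>v v)) = l \<cdot>\<^sub>v (MD *\<^sub>v v)"
      using mult_mat_vec[OF MD v] by (simp add: N_eq)
    moreover have "MD *\<^sub>v (minv MD *\<^sub>v (K *\<^sub>v v)) = K *\<^sub>v v"
      using assoc_mult_mat_vec[OF MD MD_inv(1) Kv] MD_inv(2) Kv by simp
    ultimately show "K *\<^sub>v v = l \<cdot>\<^sub>v (MD *\<^sub>v v)" by simp
  next
    assume "K *\<^sub>v v = l \<cdot>\<^sub>v (MD *\<^sub>v v)"
    then have "N *\<^sub>v v = l \<cdot>\<^sub>v (minv MD *\<^sub>v (MD *\<^sub>v v))"
      using mult_mat_vec[OF MD_inv(1), of "MD *\<^sub>v v" l] MD v by (simp add: N_eq)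
    moreover have "minv MD *\<^sub>v (MD *\<^sub>v v) = v"
      using assoc_mult_mat_vec[OF MD_inv(1) MD v] MD_inv(3) v by simp
    ultimately show "N *\<^sub>v v = l \<cdot>\<^sub>v v" by simp
  }
qed

text \<open>The three equations are the block rows of K v = l MD v. Both eigenvector descriptions
  below come from solving this system.\<close>

lemma eigenvector_N_iff:
  "eigenvector N v l \<longleftrightarrow> (\<exists>x y z. x \<in> carrier_vec n \<and> y \<in> carrier_vec m \<and> z \<in> carrier_vec p \<and>
     v = x @\<^sub>v y @\<^sub>v z \<and> \<not> (x = 0\<^sub>v n \<and> y = 0\<^sub>v m \<and> z = 0\<^sub>v p) \<and>
     A *\<^sub>v x + transpose_mat B *\<^sub>v y = l \<cdot>\<^sub>v (A *\<^sub>v x) \<and>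
     B *\<^sub>v x + transpose_mat C *\<^sub>v z = l \<cdot>\<^sub>v (S1 *\<^sub>v y) \<and>
     C *\<^sub>v y = l \<cdot>\<^sub>v (T *\<^sub>v z))"
proof -
  have block: "eigenvector N (x @\<^sub>v y @\<^sub>v z) l \<longleftrightarrow> \<not> (x = 0\<^sub>v n \<and> y = 0\<^sub>v m \<and> z = 0\<^sub>v p) \<and>
     A *\<^sub>v x + transpose_mat B *\<^sub>v y = l \<cdot>\<^sub>v (A *\<^sub>v x) \<and>
     B *\<^sub>v x + transpose_mat C *\<^sub>v z = l \<cdot>\<^sub>v (S1 *\<^sub>v y) \<and>
     C *\<^sub>v y = l \<cdot>\<^sub>v (T *\<^sub>v z)"
    if x: "x \<in> carrier_vec n" and y: "y \<in> carrier_vec m" and z: "z \<in> carrier_vec p" for x y z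
  proof -
    have v: "x @\<^sub>v y @\<^sub>v z \<in> carrier_vec (n + (m + p))" using x y z by auto
    have "x @\<^sub>v y @\<^sub>v z = 0\<^sub>v (n + (m + p)) \<longleftrightarrow> x = 0\<^sub>v n \<and> y = 0\<^sub>v m \<and> z = 0\<^sub>v p"
      unfolding zero_vec_append
      using append_vec_eq[OF x, of "0\<^sub>v n" "y @\<^sub>v z"] append_vec_eq[OF y, of "0\<^sub>v m" z] by simp
    moreover have "N *\<^sub>v (x @\<^sub>v y @\<^sub>v z) = l \<cdot>\<^sub>v (x @\<^sub>v y @\<^sub>v z) \<longleftrightarrow>
       A *\<^sub>v x + transpose_mat B *\<^sub>v y = l \<cdot>\<^sub>v (A *\<^sub>v x) \<and>
       B *\<^sub>v x + transpose_mat C *\<^sub>v z = l \<cdot>\<^sub>v (S1 *\<^sub>v y) \<and>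
       C *\<^sub>v y = l \<cdot>\<^sub>v (T *\<^sub>v z)"
    proof -
      have c: "A *\<^sub>v x + transpose_mat B *\<^sub>v y \<in> carrier_vec n" "l \<cdot>\<^sub>v (A *\<^sub>v x) \<in> carrier_vec n"
        "B *\<^sub>v x + transpose_mat C *\<^sub>v z \<in> carrier_vec m" "l \<cdot>\<^sub>v (S1 *\<^sub>v y) \<in> carrier_vec m"
        using A B C S1 x y z by auto
      show ?thesis
        unfolding N_mult_vec_iff[OF v]
        unfolding K_mult_vec[OF x y z] MD_mult_vec[OF x y z] smult_append_vec
          append_vec_eq[OF c(1,2)] append_vec_eq[OF c(3,4)] ..
    qed
    ultimately show ?thesis using N v by (simp add: eigenvector_def)
  qed
  show ?thesis
  proof
    assume ev: "eigenvector N v l"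
    then have "v \<in> carrier_vec (n + (m + p))" using N by (simp add: eigenvector_def)
    then obtain x w where x: "x \<in> carrier_vec n" and w: "w \<in> carrier_vec (m + p)" and v: "v = x @\<^sub>v w"
      by (rule append_vec_cases)
    from w obtain y z where y: "y \<in> carrier_vec m" and z: "z \<in> carrier_vec p" and w: "w = y @\<^sub>v z"
      by (rule append_vec_cases)
    show "\<exists>x y z. x \<in> carrier_vec n \<and> y \<in> carrier_vec m \<and> z \<in> carrier_vec p \<and>
     v = x @\<^sub>v y @\<^sub>v z \<and> \<not> (x = 0\<^sub>v n \<and> y = 0\<^sub>v m \<and> z = 0\<^sub>v p) \<and>
     A *\<^sub>v x + transpose_mat B *\<^sub>v y = l \<cdot>\<^sub>v (A *\<^sub>v x) \<and>
     B *\<^sub>v x + transpose_mat C *\<^sub>v z = l \<cdot>\<^sub>v (S1 *\<^sub>v y) \<and>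
     C *\<^sub>v y = l \<cdot>\<^sub>v (T *\<^sub>v z)"
      using ev x y z block[OF x y z] unfolding v w by blast
  qed (use block in blast)
qed

text \<open>At \<lambda> = 1 the terms in \<open>A\<close> cancel and leave B^T y = 0, so y = 0. The
  last row then gives T z = 0, so z = 0, and the middle row becomes B x = 0.\<close>

lemma eigenvector_N_one_iff:
  "eigenvector N v 1 \<longleftrightarrow> (\<exists>x \<in> mat_kernel B. x \<noteq> 0\<^sub>v n \<and> v = x @\<^sub>v 0\<^sub>v m @\<^sub>v 0\<^sub>v p)"
proof
  assume "eigenvector N v 1"
  then obtain x y z where x: "x \<in> carrier_vec n" and y: "y \<in> carrier_vec m" and z: "z \<in> carrier_vec p"
    and v: "v = x @\<^sub>v y @\<^sub>v z" and nz: "\<not> (x = 0\<^sub>v n \<and> y = 0\<^sub>v m \<and> z = 0\<^sub>v p)"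
    and eqs: "A *\<^sub>v x + transpose_mat B *\<^sub>v y = A *\<^sub>v x"
      "B *\<^sub>v x + transpose_mat C *\<^sub>v z = S1 *\<^sub>v y" "C *\<^sub>v y = T *\<^sub>v z"
    unfolding eigenvector_N_iff by auto
  have "transpose_mat B *\<^sub>v y = 0\<^sub>v n"
    using eqs(1) vec_add_right_cancel_zero[of "A *\<^sub>v x" n "transpose_mat B *\<^sub>v y"] A B x y by auto
  then have y0: "y = 0\<^sub>v m" using transpose_B_kernel y by blast
  then have "T *\<^sub>v z = 0\<^sub>v p" using eqs(3) mult_mat_zero_vec[OF C] by simp
  then have z0: "z = 0\<^sub>v p" using det_0_iff_vec_prod_zero_field[OF T] det_T z by blast
  have "transpose_mat C *\<^sub>v z = 0\<^sub>v m" unfolding z0 by (rule mult_mat_zero_vec) (use C in auto)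
  then have "B *\<^sub>v x = 0\<^sub>v m" using eqs(2) mult_mat_zero_vec[OF S1] y0 B x by auto
  then have "x \<in> mat_kernel B" by (rule mat_kernelI[OF B x])
  then show "\<exists>x \<in> mat_kernel B. x \<noteq> 0\<^sub>v n \<and> v = x @\<^sub>v 0\<^sub>v m @\<^sub>v 0\<^sub>v p"
    using nz v y0 z0 by blast
next
  assume "\<exists>x \<in> mat_kernel B. x \<noteq> 0\<^sub>v n \<and> v = x @\<^sub>v 0\<^sub>v m @\<^sub>v 0\<^sub>v p"
  then obtain x where xk: "x \<in> mat_kernel B" and nz: "x \<noteq> 0\<^sub>v n" and v: "v = x @\<^sub>v 0\<^sub>v m @\<^sub>v 0\<^sub>v p"
    by blast
  note x = mat_kernelD[OF B xk]
  have tr: "transpose_mat B *\<^sub>v 0\<^sub>v m = 0\<^sub>v n" "transpose_mat C *\<^sub>v 0\<^sub>v p = 0\<^sub>v m"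
    by (rule mult_mat_zero_vec, use B C in auto)+
  have "A *\<^sub>v x + transpose_mat B *\<^sub>v 0\<^sub>v m = 1 \<cdot>\<^sub>v (A *\<^sub>v x)"
    unfolding tr using A x by auto
  moreover have "B *\<^sub>v x + transpose_mat C *\<^sub>v 0\<^sub>v p = 1 \<cdot>\<^sub>v (S1 *\<^sub>v 0\<^sub>v m)"
    unfolding tr mult_mat_zero_vec[OF S1] x(2) by auto
  moreover have "C *\<^sub>v 0\<^sub>v m = 1 \<cdot>\<^sub>v (T *\<^sub>v 0\<^sub>v p)"
    unfolding mult_mat_zero_vec[OF C] mult_mat_zero_vec[OF T] by auto
  ultimately show "eigenvector N v 1"
    unfolding eigenvector_N_iff v using x(1) nz zero_carrier_vec by blast
qed

text \<open>The first row determines \<open>x\<close> from \<open>y\<close>. Because \<lambda>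
  (\<lambda> - 1) = 1, this makes B x equal to \<lambda> S1 y, the right-hand side of the second
  row. Hence C^T z = 0, so z = 0, and the third row becomes C y = 0.\<close>

lemma eigenvector_N_golden_iff:
  assumes l: "l\<^sup>2 = l + 1"
  shows "eigenvector N v l \<longleftrightarrow> (\<exists>x y. y \<in> mat_kernel C \<and> y \<noteq> 0\<^sub>v m \<and>
     x = (1 / (l - 1)) \<cdot>\<^sub>v (minv A *\<^sub>v (transpose_mat B *\<^sub>v y)) \<and> v = x @\<^sub>v y @\<^sub>v 0\<^sub>v p)"
    (is "_ \<longleftrightarrow> ?R")
proof -
  have l1: "l - 1 \<noteq> 0" using l by auto
  have gold: "1 / (l - 1) = l" using l l1 by (simp add: field_simps power2_eq_square)
  have x_iff: "A *\<^sub>v x + transpose_mat B *\<^sub>v y = l \<cdot>\<^sub>v (A *\<^sub>v x) \<longleftrightarrow>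
      x = (1 / (l - 1)) \<cdot>\<^sub>v (minv A *\<^sub>v (transpose_mat B *\<^sub>v y))"
    if x: "x \<in> carrier_vec n" and y: "y \<in> carrier_vec m" for x y
  proof -
    let ?w = "transpose_mat B *\<^sub>v y"
    have w: "?w \<in> carrier_vec n" using B y by auto
    have Ax: "A *\<^sub>v x \<in> carrier_vec n" using A x by auto
    have "A *\<^sub>v x + ?w = l \<cdot>\<^sub>v (A *\<^sub>v x) \<longleftrightarrow> A *\<^sub>v x = (1 / (l - 1)) \<cdot>\<^sub>v ?w"
      using vec_add_eq_smult_iff[OF Ax w] l1 by simp
    also have "\<dots> \<longleftrightarrow> x = (1 / (l - 1)) \<cdot>\<^sub>v (minv A *\<^sub>v ?w)"
    proof
      assume "A *\<^sub>v x = (1 / (l - 1)) \<cdot>\<^sub>v ?w"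
      then have "minv A *\<^sub>v (A *\<^sub>v x) = (1 / (l - 1)) \<cdot>\<^sub>v (minv A *\<^sub>v ?w)"
        using mult_mat_vec[OF A_inv(1) w] by simp
      then show "x = (1 / (l - 1)) \<cdot>\<^sub>v (minv A *\<^sub>v ?w)"
        using assoc_mult_mat_vec[OF A_inv(1) A x] A_inv(3) x by simp
    next
      assume x: "x = (1 / (l - 1)) \<cdot>\<^sub>v (minv A *\<^sub>v ?w)"
      have "A *\<^sub>v x = (1 / (l - 1)) \<cdot>\<^sub>v (A *\<^sub>v (minv A *\<^sub>v ?w))"
        unfolding x by (rule mult_mat_vec[OF A]) (use A_inv w in auto)
      also have "A *\<^sub>v (minv A *\<^sub>v ?w) = ?w"
        using assoc_mult_mat_vec[OF A A_inv(1) w] A_inv(2) w by simp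
      finally show "A *\<^sub>v x = (1 / (l - 1)) \<cdot>\<^sub>v ?w" .
    qed
    finally show ?thesis .
  qed
  have Bx: "B *\<^sub>v x = l \<cdot>\<^sub>v (S1 *\<^sub>v y)"
    if x: "x = (1 / (l - 1)) \<cdot>\<^sub>v (minv A *\<^sub>v (transpose_mat B *\<^sub>v y))" and y: "y \<in> carrier_vec m" for x y
  proof -
    have w: "transpose_mat B *\<^sub>v y \<in> carrier_vec n" using B y by auto
    have BA: "B * minv A \<in> carrier_mat m n" using B A_inv by auto
    have "S1 *\<^sub>v y = B *\<^sub>v (minv A *\<^sub>v (transpose_mat B *\<^sub>v y))"
      unfolding S1_eq using assoc_mult_mat_vec[OF BA, of "transpose_mat B" m y]
        assoc_mult_mat_vec[OF B A_inv(1) w] B y by simp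
    then show ?thesis
      unfolding x gold using mult_mat_vec[OF B, of "minv A *\<^sub>v (transpose_mat B *\<^sub>v y)" l] A_inv w by auto
  qed
  show ?thesis
  proof
    assume "eigenvector N v l"
    then obtain x y z where x: "x \<in> carrier_vec n" and y: "y \<in> carrier_vec m" and z: "z \<in> carrier_vec p"
      and v: "v = x @\<^sub>v y @\<^sub>v z" and nz: "\<not> (x = 0\<^sub>v n \<and> y = 0\<^sub>v m \<and> z = 0\<^sub>v p)"
      and eqs: "A *\<^sub>v x + transpose_mat B *\<^sub>v y = l \<cdot>\<^sub>v (A *\<^sub>v x)"
        "B *\<^sub>v x + transpose_mat C *\<^sub>v z = l \<cdot>\<^sub>v (S1 *\<^sub>v y)" "C *\<^sub>v y = l \<cdot>\<^sub>v (T *\<^sub>v z)"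
      unfolding eigenvector_N_iff by blast
    have x_eq: "x = (1 / (l - 1)) \<cdot>\<^sub>v (minv A *\<^sub>v (transpose_mat B *\<^sub>v y))"
      using eqs(1) x_iff[OF x y] by blast
    have "transpose_mat C *\<^sub>v z = 0\<^sub>v m"
      using eqs(2) vec_add_right_cancel_zero[of "l \<cdot>\<^sub>v (S1 *\<^sub>v y)" m "transpose_mat C *\<^sub>v z"] S1 C y z
      unfolding Bx[OF x_eq y] by auto
    then have z0: "z = 0\<^sub>v p" using transpose_C_kernel z by blast
    have "C *\<^sub>v y = 0\<^sub>v p" unfolding eqs(3) z0 mult_mat_zero_vec[OF T] by auto
    then have yk: "y \<in> mat_kernel C" by (rule mat_kernelI[OF C y])
    \<comment> \<open>With z = 0, a zero \<open>y\<close> would force x = 0 as well, and the whole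
      vector would be trivial.\<close>
    have "y \<noteq> 0\<^sub>v m"
    proof
      assume y0: "y = 0\<^sub>v m"
      have "transpose_mat B *\<^sub>v y = 0\<^sub>v n" unfolding y0 by (rule mult_mat_zero_vec) (use B in auto)
      then have "x = 0\<^sub>v n" using x_eq mult_mat_zero_vec[OF A_inv(1)] by auto
      with nz y0 z0 show False by blast
    qed
    with yk x_eq v z0 show ?R by blast
  next
    assume ?R
    then obtain x y where yk: "y \<in> mat_kernel C" and nz: "y \<noteq> 0\<^sub>v m"
      and x_eq: "x = (1 / (l - 1)) \<cdot>\<^sub>v (minv A *\<^sub>v (transpose_mat B *\<^sub>v y))"
      and v: "v = x @\<^sub>v y @\<^sub>v 0\<^sub>v p" by blast
    note y = mat_kernelD[OF C yk]
    have x: "x \<in> carrier_vec n" unfolding x_eq using A_inv B y by auto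
    have tr: "transpose_mat C *\<^sub>v 0\<^sub>v p = 0\<^sub>v m" by (rule mult_mat_zero_vec) (use C in auto)
    have "B *\<^sub>v x + transpose_mat C *\<^sub>v 0\<^sub>v p = l \<cdot>\<^sub>v (S1 *\<^sub>v y)"
      unfolding tr Bx[OF x_eq y(1)] using S1 y by auto
    moreover have "C *\<^sub>v y = l \<cdot>\<^sub>v (T *\<^sub>v 0\<^sub>v p)"
      unfolding y(2) mult_mat_zero_vec[OF T] by auto
    ultimately show "eigenvector N v l"
      unfolding eigenvector_N_iff v using x y(1) nz x_iff[OF x y(1)] x_eq zero_carrier_vec by blast
  qed
qed

section \<open>Exact algebraic multiplicities\<close>

lemma order_one:
  assumes mn: "m \<le> n"
  shows "Polynomial.order 1 (char_poly N) = n - m"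
proof -
  have neq: "(1 + sqrt 5) / 2 \<noteq> 1" "(1 - sqrt 5) / 2 \<noteq> 1"
    using golden_root[of "(1 + sqrt 5) / 2"] golden_root[of "(1 - sqrt 5) / 2"] by auto
  then have neq': "complex_of_real ((1 + sqrt 5) / 2) \<noteq> 1" "complex_of_real ((1 - sqrt 5) / 2) \<noteq> 1"
    by (metis of_real_eq_1_iff)+
  \<comment> \<open>Every cubic takes the value -1 at 1, whatever \<mu> is.\<close>
  have "count (\<Sum>\<mu>\<in>#mus. proots (cubic \<mu>)) 1 = 0" by (rule count_cubics) simp
  then show ?thesis
    unfolding order_char_poly_N[OF mn] proots_R of_real_1 using neq'
    by (simp only: count_union count_replicate_mset) simp
qed

lemma order_golden:
  assumes mn: "m \<le> n" and "l = (1 + sqrt 5) / 2 \<or> l = (1 - sqrt 5) / 2"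
  shows "Polynomial.order l (char_poly N) = m - p"
proof -
  have l: "l\<^sup>2 = l + 1" by (rule golden_root) (use assms in blast)
  then have l1: "l \<noteq> 1" by auto
  have "count (\<Sum>\<mu>\<in>#mus. proots (cubic \<mu>)) (complex_of_real l) = 0"
  proof (rule count_cubics)
    fix \<mu> assume "\<mu> \<in># mus"
    then have nz: "\<mu> \<noteq> 0" using zero_notin_mus by auto
    have sq: "complex_of_real l * complex_of_real l = complex_of_real l + 1"
      using arg_cong[OF l, of complex_of_real] by (simp add: power2_eq_square)
    \<comment> \<open>The terms with \<mu> are separated from \<lambda> (\<lambda>^2 - \<lambda> -
      1), which vanishes at a golden root.\<close>
    have "poly (cubic \<mu>) (complex_of_real l)
        = \<mu> * (1 - complex_of_real l)
          + complex_of_real l * (complex_of_real l * complex_of_real l - complex_of_real l - 1)"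
      by (simp add: algebra_simps)
    also have "\<dots> = \<mu> * (1 - complex_of_real l)" unfolding sq by simp
    finally show "poly (cubic \<mu>) (complex_of_real l) \<noteq> 0" using nz l1 by simp
  qed
  \<comment> \<open>If the two golden roots coincided, their multiplicities would add.\<close>
  moreover have "(1 + sqrt 5) / 2 \<noteq> (1 - sqrt 5) / (2 :: real)" by simp
  then have "complex_of_real ((1 + sqrt 5) / 2) \<noteq> complex_of_real ((1 - sqrt 5) / 2)"
    by (simp only: of_real_eq_iff not_False_eq_True)
  moreover have "complex_of_real l \<noteq> 1" using l1 by simp
  ultimately show ?thesis
    unfolding order_char_poly_N[OF mn] proots_R using assms(2)
    by (elim disjE) (simp_all only: count_union count_replicate_mset if_True if_False eq_commute, simp_all)
qed

end

section \<open>Spectrum and eigenvectors of the preconditioned matrix\<close>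

theorem theorem2p1:
  fixes n m p :: nat
    and A B C D S1 S2 S2hat K MD N :: "real mat"
  assumes "A \<in> carrier_mat n n" and "B \<in> carrier_mat m n" and "C \<in> carrier_mat p m"
    and "D = 0\<^sub>m m m"
    and "K = double_saddle_mat A B C D"
    and "invertible_mat K"
    and "spd_mat n A"
    and "n \<ge> m"
    and "S1 = B * minv A * transpose_mat B"
    and "invertible_mat S1"
    and "S2 = C * minv S1 * transpose_mat C"
    and "invertible_mat S2"
    and "spd_mat p S2hat"
    and "MD = diag_block_mat [A, S1, S2hat]"
    and "N = minv MD * K"
  shows
    "Polynomial.order 1 (char_poly N) = n - m
     \<and> (\<exists>X. kernel.basis n B X \<and> finite X \<and> card X = n - m)
     \<and> (\<forall>v. eigenvector N v 1 \<longleftrightarrow>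
           (\<exists>x \<in> mat_kernel B. x \<noteq> 0\<^sub>v n \<and> v = x @\<^sub>v 0\<^sub>v m @\<^sub>v 0\<^sub>v p))
     \<and> (\<forall>l \<in> {(1 + sqrt 5) / 2, (1 - sqrt 5) / 2}.
           Polynomial.order l (char_poly N) = m - p \<and>
           (\<forall>v. eigenvector N v l \<longleftrightarrow>
              (\<exists>x y. y \<in> mat_kernel C \<and> y \<noteq> 0\<^sub>v m \<and>
                 x = (1 / (l - 1)) \<cdot>\<^sub>v (minv A *\<^sub>v (transpose_mat B *\<^sub>v y)) \<and>
                 v = x @\<^sub>v y @\<^sub>v 0\<^sub>v p)))
     \<and> size (gen_eigenvalues_mset S2 S2hat) = p
     \<and> eigenvalues_mset N =
         replicate_mset (n - m) 1
         + replicate_mset (m - p) (complex_of_real ((1 + sqrt 5) / 2))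
         + replicate_mset (m - p) (complex_of_real ((1 - sqrt 5) / 2))
         + (\<Sum>\<mu> \<in># gen_eigenvalues_mset S2 S2hat. proots [:\<mu>, - (1 + \<mu>), - 1, 1:])"
proof -
  have square: "S1 \<in> carrier_mat m m" "S2 \<in> carrier_mat p p"
    using assms(2,3,9-12) by (auto simp: invertible_mat_def)
  interpret ds: double_saddle n m p A B C S1 S2 S2hat
  proof
    show "det A \<noteq> 0" "det S2hat \<noteq> 0"
      using assms(7,13) by (auto dest: spd_mat_det_nonzero)
    show "det S1 \<noteq> 0" "det S2 \<noteq> 0"
      using assms(10,12) square invertible_mat_det_nonzero by blast+
    show "S2hat \<in> carrier_mat p p" using assms(13) by (simp add: spd_mat_def)
  qed (use assms in auto)
  have N_eq: "N = ds.N"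
    using assms(4,5,14,15) by (simp add: ds.N_def ds.MD_def ds.K_def)
  have kernel: "\<exists>X. kernel.basis n B X \<and> finite X \<and> card X = n - m"
    by (rule kernel_basis_of_right_inverse[OF assms(2) _ ds.B_right_inverse])
      (use assms(2) ds.A_inv ds.S1_inv in auto)
  \<comment> \<open>By \<open>char_poly_hom\<close>, complexifying the matrix complexifies its
    characteristic polynomial.\<close>
  have "eigenvalues_mset ds.N = proots ds.R"
    unfolding eigenvalues_mset_def of_real_hom.char_poly_hom[OF ds.N]
      ds.char_poly_N_factorization[OF assms(8)] ..
  then have spectrum: "eigenvalues_mset N =
         replicate_mset (n - m) 1
         + replicate_mset (m - p) (complex_of_real ((1 + sqrt 5) / 2))
         + replicate_mset (m - p) (complex_of_real ((1 - sqrt 5) / 2))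
         + (\<Sum>\<mu> \<in># gen_eigenvalues_mset S2 S2hat. proots [:\<mu>, - (1 + \<mu>), - 1, 1:])"
    unfolding N_eq ds.proots_R ds.mus_def .
  have golden: "Polynomial.order l (char_poly N) = m - p \<and>
           (\<forall>v. eigenvector N v l \<longleftrightarrow>
              (\<exists>x y. y \<in> mat_kernel C \<and> y \<noteq> 0\<^sub>v m \<and>
                 x = (1 / (l - 1)) \<cdot>\<^sub>v (minv A *\<^sub>v (transpose_mat B *\<^sub>v y)) \<and>
                 v = x @\<^sub>v y @\<^sub>v 0\<^sub>v p))"
    if l: "l \<in> {(1 + sqrt 5) / 2, (1 - sqrt 5) / 2}" for l
  proof -
    from l have "l = (1 + sqrt 5) / 2 \<or> l = (1 - sqrt 5) / 2" by simp
    then show ?thesis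
      unfolding N_eq
      using ds.order_golden[OF assms(8)] ds.eigenvector_N_golden_iff[OF golden_root] by blast
  qed
  have order: "Polynomial.order 1 (char_poly N) = n - m"
    unfolding N_eq by (rule ds.order_one[OF assms(8)])
  have ev: "eigenvector N v 1 \<longleftrightarrow>
      (\<exists>x \<in> mat_kernel B. x \<noteq> 0\<^sub>v n \<and> v = x @\<^sub>v 0\<^sub>v m @\<^sub>v 0\<^sub>v p)" for v
    unfolding N_eq by (rule ds.eigenvector_N_one_iff)
  have size: "size (gen_eigenvalues_mset S2 S2hat) = p"
    using ds.size_mus by (simp only: ds.mus_def)
  show ?thesis
    by (intro conjI allI ballI order kernel ev golden size spectrum)
qed

end
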